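(* Let $\Delta\subset\mathbb{R}^n$ be a (nondegenerate, $n$-dimensional) simplex and let $L\subset\mathbb{R}^n$ be a convex body. Then $$\frac{n}{d_\Delta(L)}\le\rho_\Delta(L)\le n-1+\frac{1}{d_\Delta(L)}.$$
   Context: A convex body is a compact convex set with nonempty interior. For compact convex $K,L\subset\mathbb{R}^n$: $\lambda_K(L):=\inf\{\lambda\ge 0:\exists x\in\mathbb{R}^n,\ L\subset x+\lambda K\}$ (size of the smallest homothet of $K$ containing $L$), and $\mu_K(L):=\sup\{\lambda\ge 0:\exists x\in\mathbb{R}^n,\ x+\lambda K\subseteq L\}$ (size of the largest homothet of $K$ contained in $L$). Set $$\rho_\Delta(L):=\frac{\lambda_{-\Delta}(L)}{\lambda_\Delta(L)},\qquad d_\Delta(L):=\frac{\lambda_\Delta(L)}{\mu_\Delta(L)}.$$ *)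

theory Defs
  imports "HOL-Analysis.Analysis"
begin

definition convex_body :: "'a::euclidean_space set \<Rightarrow> bool" where
  "convex_body L \<longleftrightarrow> compact L \<and> convex L \<and> interior L \<noteq> {}"

definition homothet :: "'a::real_vector \<Rightarrow> real \<Rightarrow> 'a set \<Rightarrow> 'a set" where
  "homothet x r K = (\<lambda>y. x + r *\<^sub>R y) ` K"

(* Inf and Sup below are taken in the reals. For a convex body K in positive dimension and a
   nonempty compact L the sets are nonempty and bounded, so no default value is involved. *)

definition circumscribed_ratio :: "'a::euclidean_space set \<Rightarrow> 'a set \<Rightarrow> real" where
  "circumscribed_ratio K L = Inf {r. r \<ge> 0 \<and> (\<exists>x. L \<subseteq> homothet x r K)}"

definition inscribed_ratio :: "'a::euclidean_space set \<Rightarrow> 'a set \<Rightarrow> real" where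
  "inscribed_ratio K L = Sup {r. r \<ge> 0 \<and> (\<exists>x. homothet x r K \<subseteq> L)}"

definition rho_ratio :: "'a::euclidean_space set \<Rightarrow> 'a set \<Rightarrow> real" where
  "rho_ratio \<Delta> L = circumscribed_ratio (uminus ` \<Delta>) L / circumscribed_ratio \<Delta> L"

definition d_ratio :: "'a::euclidean_space set \<Rightarrow> 'a set \<Rightarrow> real" where
  "d_ratio \<Delta> L = circumscribed_ratio \<Delta> L / inscribed_ratio \<Delta> L"

end

theory Submission
  imports Defs
begin

text \<open>
  Write $n$ for the dimension and let $V$ be the vertex set of \<open>\<Delta>\<close>. The barycentric coordinate of
  a vertex \<open>v\<close> is an affine function; let $l_v$ be its linear part. Since the coordinates add up to
  $1$, the $l_v$ add up to $0$, and the position of a point is the same thing as a tuple of numbers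
  $l_v$ with sum $0$. In these coordinates a homothet of \<open>\<Delta>\<close> is given by a lower bound on
  every $l_v$, and its ratio is minus the sum of these bounds. Hence the smallest homothet
  of \<open>\<Delta>\<close> that contains \<open>L\<close> has ratio $\lambda = -\sum_v \min_L l_v$, and, on replacing \<open>L\<close> by \<open>-L\<close>,
  the smallest homothet of \<open>-\<Delta>\<close> that contains \<open>L\<close> has ratio $\lambda' = \sum_v \max_L l_v$
  (\<open>circumscribed_ratio_eq\<close>, \<open>circumscribed_ratio_uminus_eq\<close>). With $\mu$ the inscribed ratio, the
  two claims are $n\mu \le \lambda'$ and $\lambda' \le (n-1)\lambda + \mu$, divided by $\lambda$.

  The first one holds because a homothet of ratio $r$ inside \<open>L\<close> has its vertices in \<open>L\<close>, and the
  maxima of the $l_v$ over these vertices add up to $rn$ (\<open>homothet_subset_bound\<close>).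

  For the second one, which is trivial if $\lambda' - (n-1)\lambda$ is negative, a homothet of
  exactly this ratio is found inside \<open>L\<close>. Let $q_w$ be a
  point of \<open>L\<close> where $l_w$ is largest. A point that has, for each $w$, at least the
  coordinates of $q_w$ other than the one belonging to $w$, cannot be separated from \<open>L\<close>:
  a linear functional, normalised to vanish at the vertex $k$ where it is least, has nonnegative
  weights and does not see coordinate $k$, so it is no smaller at the point than at $q_k$
  (\<open>mem_if_dominates\<close>). These requirements are lower bounds on the $l_v$, so they hold on a
  homothet of \<open>\<Delta>\<close>. Measured from the minima over \<open>L\<close>, all coordinates are nonnegative,
  those of $q_w$ add up to $\lambda$, and the maximum over \<open>w \<noteq> v\<close> may be replaced by the sum; summing
  up, the ratio is still $\lambda' - (n-1)\lambda$ (\<open>exists_inscribed_homothet\<close>).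
\<close>

section \<open>Barycentric coordinates of a full-dimensional simplex\<close>

locale full_simplex =
  fixes V :: "'a::euclidean_space set"
  assumes indep: "\<not> affine_dependent V"
    and spanning: "affine hull V = UNIV"
begin

definition bary :: "'a \<Rightarrow> 'a \<Rightarrow> real" where
  "bary x = (SOME u. sum u V = 1 \<and> (\<Sum>v\<in>V. u v *\<^sub>R v) = x)"

definition slope :: "'a \<Rightarrow> 'a \<Rightarrow> real" where
  "slope v x = bary x v - bary 0 v"

lemma finite_V: "finite V"
  using indep aff_independent_finite by blast

lemma V_nonempty: "V \<noteq> {}"
  using spanning by auto

lemma card_V: "card V = DIM('a) + 1"
  using aff_dim_affine_independent[OF indep] spanning
  by (metis aff_dim_UNIV aff_dim_affine_hull add.commute of_nat_1 of_nat_add of_nat_eq_iff)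

lemma sum_bary: "sum (bary x) V = 1"
  and bary_repr: "(\<Sum>v\<in>V. bary x v *\<^sub>R v) = x"
proof -
  have "x \<in> affine hull V"
    using spanning by simp
  then have "\<exists>u. sum u V = 1 \<and> (\<Sum>v\<in>V. u v *\<^sub>R v) = x"
    by (simp add: affine_hull_finite[OF finite_V])
  then have "sum (bary x) V = 1 \<and> (\<Sum>v\<in>V. bary x v *\<^sub>R v) = x"
    unfolding bary_def by (rule someI_ex)
  then show "sum (bary x) V = 1" "(\<Sum>v\<in>V. bary x v *\<^sub>R v) = x"
    by auto
qed

lemma bary_unique:
  assumes "sum u V = 1" "(\<Sum>v\<in>V. u v *\<^sub>R v) = x" "v \<in> V"
  shows "bary x v = u v"
proof (rule ccontr)
  assume "bary x v \<noteq> u v"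
  moreover have "(\<Sum>v\<in>V. bary x v - u v) = 0"
    using assms by (simp add: sum_subtractf sum_bary)
  moreover have "(\<Sum>v\<in>V. (bary x v - u v) *\<^sub>R v) = 0"
    using assms by (simp add: scaleR_left_diff_distrib sum_subtractf bary_repr)
  ultimately have "affine_dependent V"
    unfolding affine_dependent_explicit_finite[OF finite_V]
    using assms(3) by (intro exI[of _ "\<lambda>v. bary x v - u v"]) auto
  then show False
    using indep by simp
qed

lemma mem_simplex_iff: "x \<in> convex hull V \<longleftrightarrow> (\<forall>v\<in>V. 0 \<le> bary x v)"
proof
  assume "x \<in> convex hull V"
  then obtain u where "\<forall>v\<in>V. 0 \<le> u v" "sum u V = 1" "(\<Sum>v\<in>V. u v *\<^sub>R v) = x"
    by (auto simp: convex_hull_finite[OF finite_V])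
  then show "\<forall>v\<in>V. 0 \<le> bary x v"
    using bary_unique by auto
next
  assume "\<forall>v\<in>V. 0 \<le> bary x v"
  then show "x \<in> convex hull V"
    unfolding convex_hull_finite[OF finite_V] using sum_bary bary_repr by blast
qed

lemma sum_slope: "(\<Sum>v\<in>V. slope v x) = 0"
  by (simp add: slope_def sum_subtractf sum_bary)

lemma slope_repr: "(\<Sum>v\<in>V. slope v x *\<^sub>R v) = x"
  by (simp add: slope_def scaleR_left_diff_distrib sum_subtractf bary_repr)

lemma slope_unique:
  assumes "sum t V = 0" "(\<Sum>v\<in>V. t v *\<^sub>R v) = x" "v \<in> V"
  shows "slope v x = t v"
proof -
  have "bary x v = t v + bary 0 v"
    by (rule bary_unique)
      (use assms in \<open>simp_all add: sum.distrib sum_bary scaleR_left_distrib bary_repr\<close>)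
  then show ?thesis
    by (simp add: slope_def)
qed

lemma exists_slopes:
  assumes "sum t V = 0"
  obtains x where "\<And>v. v \<in> V \<Longrightarrow> slope v x = t v"
  using slope_unique[OF assms refl] by blast

lemma linear_slope:
  assumes "v \<in> V"
  shows "linear (slope v)"
proof (rule linearI)
  show "slope v (x + y) = slope v x + slope v y" for x y
    by (rule slope_unique[OF _ _ assms])
      (simp_all add: sum.distrib sum_slope scaleR_left_distrib slope_repr)
  show "slope v (r *\<^sub>R x) = r *\<^sub>R slope v x" for r x
  proof (rule slope_unique[OF _ _ assms])
    show "(\<Sum>v\<in>V. r *\<^sub>R slope v x) = 0"
      by (simp add: sum_slope flip: sum_distrib_left)
    show "(\<Sum>v\<in>V. (r *\<^sub>R slope v x) *\<^sub>R v) = r *\<^sub>R x"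
      by (simp add: slope_repr flip: scaleR_scaleR scaleR_sum_right)
  qed
qed

lemma slope_vertex:
  assumes "v \<in> V"
  shows "slope v v = 1 - bary 0 v"
proof -
  let ?u = "\<lambda>w. if w = v then 1 else (0::real)"
  have "sum ?u V = 1"
    using finite_V assms by simp
  moreover have "(\<Sum>w\<in>V. ?u w *\<^sub>R w) = v"
    using finite_V assms by (simp add: if_distrib[of "\<lambda>c. c *\<^sub>R _"] cong: if_cong)
  ultimately have "bary v v = 1"
    using bary_unique[of ?u v v] assms by simp
  then show ?thesis
    by (simp add: slope_def)
qed

lemma sum_slope_vertices: "(\<Sum>v\<in>V. slope v v) = DIM('a)"
  by (simp add: slope_vertex sum_subtractf sum_bary card_V)

section \<open>Circumscribed homothets\<close>

text \<open>Dividing by the ratio reduces this to the barycentric description of the simplex. For ratio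
  $0$ the inequalities still cut out a single point, since the slopes add up to $0$.\<close>

lemma mem_homothet_iff:
  assumes "0 \<le> r"
  shows "y \<in> homothet x r (convex hull V) \<longleftrightarrow>
    (\<forall>v\<in>V. slope v x - r * bary 0 v \<le> slope v y)"
proof
  assume "y \<in> homothet x r (convex hull V)"
  then obtain z where z: "z \<in> convex hull V" "y = x + r *\<^sub>R z"
    by (auto simp: homothet_def)
  show "\<forall>v\<in>V. slope v x - r * bary 0 v \<le> slope v y"
  proof
    fix v assume v: "v \<in> V"
    have "0 \<le> r * (slope v z + bary 0 v)"
      using z v assms by (simp add: mem_simplex_iff slope_def)
    then show "slope v x - r * bary 0 v \<le> slope v y"
      using z linear_slope[OF v] by (simp add: linear_add linear_cmul algebra_simps)
  qed
next
  assume *: "\<forall>v\<in>V. slope v x - r * bary 0 v \<le> slope v y"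
  show "y \<in> homothet x r (convex hull V)"
  proof (cases "r = 0")
    case True
    have "0 \<le> slope v (y - x)" if "v \<in> V" for v
      using * that True linear_slope[OF that] by (simp add: linear_diff)
    then have "\<forall>v\<in>V. slope v (y - x) = 0"
      using sum_slope[of "y - x"] finite_V by (simp add: sum_nonneg_eq_0_iff)
    then have "y - x = 0"
      using slope_repr[of "y - x"] by simp
    moreover obtain v where "v \<in> convex hull V"
      using V_nonempty by (metis convex_hull_eq_empty ex_in_conv)
    ultimately show ?thesis
      using True by (auto simp: homothet_def)
  next
    case False
    with assms have r: "0 < r" by simp
    define z where "z = (1 / r) *\<^sub>R (y - x)"
    have "z \<in> convex hull V"
      unfolding mem_simplex_iff
    proof
      fix v assume v: "v \<in> V"
      have "slope v z = (slope v y - slope v x) / r"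
        using linear_slope[OF v] by (simp add: z_def linear_cmul linear_diff diff_divide_distrib)
      then have "bary z v = (slope v y - slope v x) / r + bary 0 v"
        by (simp add: slope_def)
      moreover have "- bary 0 v \<le> (slope v y - slope v x) / r"
        using * v r by (simp add: pos_le_divide_eq algebra_simps)
      ultimately show "0 \<le> bary z v"
        by linarith
    qed
    moreover have "y = x + r *\<^sub>R z"
      using r by (simp add: z_def)
    ultimately show ?thesis
      by (auto simp: homothet_def)
  qed
qed

text \<open>The family \<open>t\<close> of lower bounds is arbitrary apart from its sum: translating a homothet
  changes its bounds by slopes of the translation vector, which form any family with sum $0$.\<close>

lemma exists_homothet_with_bounds:
  assumes "0 \<le> r" and "sum t V = - r"
  obtains x where "\<And>y. y \<in> homothet x r (convex hull V) \<longleftrightarrow> (\<forall>v\<in>V. t v \<le> slope v y)"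
proof -
  have "(\<Sum>v\<in>V. t v + r * bary 0 v) = 0"
    using assms by (simp add: sum.distrib sum_bary flip: sum_distrib_left)
  then obtain x where "\<And>v. v \<in> V \<Longrightarrow> slope v x = t v + r * bary 0 v"
    using exists_slopes by blast
  then have "y \<in> homothet x r (convex hull V) \<longleftrightarrow> (\<forall>v\<in>V. t v \<le> slope v y)" for y
    using mem_homothet_iff[OF assms(1)] by simp
  then show ?thesis
    using that by blast
qed

lemma circumscribed_ratio_eq:
  assumes p: "\<And>v. v \<in> V \<Longrightarrow> p v \<in> L"
    and min: "\<And>v y. v \<in> V \<Longrightarrow> y \<in> L \<Longrightarrow> slope v (p v) \<le> slope v y"
  shows "circumscribed_ratio (convex hull V) L = - (\<Sum>v\<in>V. slope v (p v))" (is "_ = ?r")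
    and "0 \<le> - (\<Sum>v\<in>V. slope v (p v))"
    and "\<exists>x. L \<subseteq> homothet x (- (\<Sum>v\<in>V. slope v (p v))) (convex hull V)"
proof -
  obtain v where "v \<in> V"
    using V_nonempty by blast
  then have "(\<Sum>w\<in>V. slope w (p w)) \<le> (\<Sum>w\<in>V. slope w (p v))"
    using p min by (intro sum_mono) blast
  then show r0: "0 \<le> ?r"
    by (simp add: sum_slope)
  obtain x where
    "\<And>y. y \<in> homothet x ?r (convex hull V) \<longleftrightarrow> (\<forall>v\<in>V. slope v (p v) \<le> slope v y)"
    using exists_homothet_with_bounds[OF r0, of "\<lambda>v. slope v (p v)"] by auto
  then show ex: "\<exists>x. L \<subseteq> homothet x ?r (convex hull V)"
    using min by blast
  show "circumscribed_ratio (convex hull V) L = ?r"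
    unfolding circumscribed_ratio_def
  proof (rule cInf_eq_minimum)
    show "?r \<in> {r. 0 \<le> r \<and> (\<exists>x. L \<subseteq> homothet x r (convex hull V))}"
      using r0 ex by blast
    fix r assume "r \<in> {r. 0 \<le> r \<and> (\<exists>x. L \<subseteq> homothet x r (convex hull V))}"
    then obtain x where r: "0 \<le> r" and x: "L \<subseteq> homothet x r (convex hull V)"
      by blast
    have "(\<Sum>v\<in>V. slope v x - r * bary 0 v) \<le> (\<Sum>v\<in>V. slope v (p v))"
      using x p mem_homothet_iff[OF r] by (intro sum_mono) blast
    then show "?r \<le> r"
      by (simp add: sum_subtractf sum_slope sum_bary flip: sum_distrib_left)
  qed
qed

end

lemma circumscribed_ratio_uminus:
  "circumscribed_ratio (uminus ` K) L = circumscribed_ratio K (uminus ` L)"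
proof -
  have h: "homothet x r (uminus ` K) = uminus ` homothet (- x) r K" for x :: 'a and r
    by (simp add: homothet_def image_image)
  have "(\<exists>x. L \<subseteq> homothet x r (uminus ` K)) \<longleftrightarrow> (\<exists>x. uminus ` L \<subseteq> homothet x r K)" for r
  proof -
    have "L \<subseteq> homothet x r (uminus ` K) \<longleftrightarrow> uminus ` L \<subseteq> homothet (- x) r K" for x
      unfolding h by (force simp: image_iff subset_eq)
    then show ?thesis
      by (metis minus_minus)
  qed
  then show ?thesis
    by (simp add: circumscribed_ratio_def)
qed

context full_simplex
begin

lemma circumscribed_ratio_uminus_eq:
  assumes q: "\<And>v. v \<in> V \<Longrightarrow> q v \<in> L"
    and max: "\<And>v y. v \<in> V \<Longrightarrow> y \<in> L \<Longrightarrow> slope v y \<le> slope v (q v)"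
  shows "circumscribed_ratio (uminus ` (convex hull V)) L = (\<Sum>v\<in>V. slope v (q v))"
proof -
  have neg: "slope v (- y) = - slope v y" if "v \<in> V" for v y
    using linear_slope[OF that] by (rule linear_neg)
  have "circumscribed_ratio (convex hull V) (uminus ` L) = - (\<Sum>v\<in>V. slope v (- q v))"
    by (rule circumscribed_ratio_eq(1)) (use q max neg in auto)
  then show ?thesis
    by (simp add: circumscribed_ratio_uminus neg sum_negf)
qed

section \<open>Inscribed homothets\<close>

lemma homothet_subset_bound:
  assumes max: "\<And>v y. v \<in> V \<Longrightarrow> y \<in> L \<Longrightarrow> slope v y \<le> slope v (q v)"
    and sub: "homothet x r (convex hull V) \<subseteq> L"
  shows "r * DIM('a) \<le> (\<Sum>v\<in>V. slope v (q v))"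
proof -
  have "slope v x + r * slope v v \<le> slope v (q v)" if v: "v \<in> V" for v
  proof -
    have "v \<in> convex hull V"
      using v by (rule hull_inc)
    then have "x + r *\<^sub>R v \<in> L"
      using sub by (auto simp: homothet_def)
    then show ?thesis
      using max[OF v] linear_slope[OF v] by (force simp: linear_add linear_cmul)
  qed
  then have "(\<Sum>v\<in>V. slope v x + r * slope v v) \<le> (\<Sum>v\<in>V. slope v (q v))"
    by (rule sum_mono)
  then show ?thesis
    by (simp add: sum.distrib sum_slope sum_slope_vertices flip: sum_distrib_left)
qed

text \<open>A functional separating \<open>y\<close> from \<open>L\<close> may be shifted by a constant on the vertices, because
  slopes add up to $0$. Shifted so that its least vertex value, at \<open>k\<close>, becomes $0$, it is a
  nonnegative combination of the slopes of the vertices other than \<open>k\<close>, so it is at least as large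
  at \<open>y\<close> as at \<open>q k\<close>.\<close>

lemma mem_if_dominates:
  assumes L: "closed L" "convex L"
    and q: "\<And>k. k \<in> V \<Longrightarrow> q k \<in> L"
    and dom: "\<And>k v. k \<in> V \<Longrightarrow> v \<in> V \<Longrightarrow> v \<noteq> k \<Longrightarrow> slope v (q k) \<le> slope v y"
  shows "y \<in> L"
proof (rule ccontr)
  assume "y \<notin> L"
  then obtain a b where ab: "a \<bullet> y < b" "\<forall>x\<in>L. b < a \<bullet> x"
    using separating_hyperplane_closed_point[OF L(2,1)] by blast
  obtain k where k: "k \<in> V" "\<And>v. v \<in> V \<Longrightarrow> a \<bullet> k \<le> a \<bullet> v"
    using finite_V V_nonempty by (metis arg_min_if_finite(1) arg_min_least)
  have expand: "a \<bullet> z = (\<Sum>v\<in>V. slope v z * (a \<bullet> v - a \<bullet> k))" for z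
  proof -
    have "a \<bullet> z = a \<bullet> (\<Sum>v\<in>V. slope v z *\<^sub>R v)"
      by (simp add: slope_repr)
    also have "\<dots> = (\<Sum>v\<in>V. slope v z * (a \<bullet> v))"
      by (simp add: inner_sum_right)
    also have "\<dots> = (\<Sum>v\<in>V. slope v z * (a \<bullet> v - a \<bullet> k))"
      by (simp add: right_diff_distrib sum_subtractf sum_slope flip: sum_distrib_right)
    finally show ?thesis .
  qed
  have "a \<bullet> q k \<le> a \<bullet> y"
    unfolding expand[of "q k"] expand[of y]
  proof (rule sum_mono)
    fix v assume v: "v \<in> V"
    show "slope v (q k) * (a \<bullet> v - a \<bullet> k) \<le> slope v y * (a \<bullet> v - a \<bullet> k)"
      using dom[OF k(1) v] k(2)[OF v] by (cases "v = k") (auto intro: mult_right_mono)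
  qed
  then show False
    using ab q[OF k(1)] by force
qed

text \<open>If \<open>p\<close> and \<open>q\<close> select points of \<open>L\<close> where the slopes are least and greatest, the first sum in
  \<open>r\<close> is the circumscribed ratio of \<open>L\<close> for the negative of the simplex, and the second sum is minus
  the one for the simplex itself.\<close>

lemma exists_inscribed_homothet:
  fixes p q :: "'a \<Rightarrow> 'a"
  defines "r \<equiv> (\<Sum>v\<in>V. slope v (q v)) + (real DIM('a) - 1) * (\<Sum>v\<in>V. slope v (p v))"
  assumes L: "closed L" "convex L"
    and min: "\<And>v y. v \<in> V \<Longrightarrow> y \<in> L \<Longrightarrow> slope v (p v) \<le> slope v y"
    and q: "\<And>v. v \<in> V \<Longrightarrow> q v \<in> L"
    and r: "0 \<le> r"
  shows "\<exists>x. homothet x r (convex hull V) \<subseteq> L"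
proof -
  define m where "m v = slope v (p v)" for v
  define h where "h v k = slope v (q k) - m v" for v k
  define t where "t v = m v + (\<Sum>k\<in>V - {v}. h v k)" for v
  \<comment> \<open>The bound \<open>t v\<close> has to be at least \<open>slope v (q k)\<close> for all \<open>k \<noteq> v\<close> only. Adding up the heights
    \<open>h v k\<close> costs more than taking their maximum, but makes the sum of all bounds computable.\<close>
  have h0: "0 \<le> h v k" if "v \<in> V" "k \<in> V" for v k
    using min that q by (simp add: h_def m_def)
  have col: "(\<Sum>v\<in>V. h v k) = - sum m V" for k
    by (simp add: h_def sum_subtractf sum_slope)
  have "sum t V = sum m V + (\<Sum>v\<in>V. (\<Sum>k\<in>V. h v k) - h v v)"
    using finite_V by (simp add: t_def sum.distrib sum_diff1)
  also have "\<dots> = sum m V + (\<Sum>k\<in>V. \<Sum>v\<in>V. h v k) - (\<Sum>v\<in>V. h v v)"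
    by (subst sum.swap) (simp add: sum_subtractf)
  also have "\<dots> = sum m V - real (card V) * sum m V - (\<Sum>v\<in>V. slope v (q v)) + sum m V"
    unfolding col by (simp add: h_def sum_subtractf)
  also have "\<dots> = - r"
    by (simp add: r_def card_V m_def algebra_simps)
  finally obtain x where
    x: "\<And>y. y \<in> homothet x r (convex hull V) \<longleftrightarrow> (\<forall>v\<in>V. t v \<le> slope v y)"
    using exists_homothet_with_bounds[OF r] by blast
  have "y \<in> L" if y: "y \<in> homothet x r (convex hull V)" for y
  proof (rule mem_if_dominates[OF L q])
    fix k v assume kv: "k \<in> V" "v \<in> V" "v \<noteq> k"
    have "h v k \<le> (\<Sum>k\<in>V - {v}. h v k)"
      using kv h0 finite_V by (intro member_le_sum) auto
    then have "slope v (q k) \<le> t v"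
      by (simp add: t_def h_def)
    also have "\<dots> \<le> slope v y"
      using y x kv by blast
    finally show "slope v (q k) \<le> slope v y" .
  qed
  then show ?thesis
    by blast
qed

section \<open>The inequalities\<close>

lemma exists_extremal_points:
  assumes "compact L" "L \<noteq> {}"
  obtains p q where
    "\<And>v. v \<in> V \<Longrightarrow> p v \<in> L" "\<And>v y. v \<in> V \<Longrightarrow> y \<in> L \<Longrightarrow> slope v (p v) \<le> slope v y"
    "\<And>v. v \<in> V \<Longrightarrow> q v \<in> L" "\<And>v y. v \<in> V \<Longrightarrow> y \<in> L \<Longrightarrow> slope v y \<le> slope v (q v)"
proof -
  have cont: "continuous_on L (slope v)" if "v \<in> V" for v
    using linear_slope[OF that] by (simp add: linear_continuous_on linear_linear)
  have "\<forall>v\<in>V. \<exists>x\<in>L. \<forall>y\<in>L. slope v x \<le> slope v y"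
    using continuous_attains_inf[OF assms cont] by blast
  then obtain p where p: "\<forall>v\<in>V. p v \<in> L \<and> (\<forall>y\<in>L. slope v (p v) \<le> slope v y)"
    by metis
  have "\<forall>v\<in>V. \<exists>x\<in>L. \<forall>y\<in>L. slope v y \<le> slope v x"
    using continuous_attains_sup[OF assms cont] by blast
  then obtain q where q: "\<forall>v\<in>V. q v \<in> L \<and> (\<forall>y\<in>L. slope v y \<le> slope v (q v))"
    by metis
  show ?thesis
    using that[of p q] p q by blast
qed

lemma ratio_bounds:
  assumes L: "convex_body L"
  shows "0 < circumscribed_ratio (convex hull V) L" (is "0 < ?c")
    and "DIM('a) * inscribed_ratio (convex hull V) L
      \<le> circumscribed_ratio (uminus ` (convex hull V)) L" (is "_ * ?i \<le> ?c'")
    and "circumscribed_ratio (uminus ` (convex hull V)) L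
      \<le> (real DIM('a) - 1) * circumscribed_ratio (convex hull V) L
        + inscribed_ratio (convex hull V) L"
proof -
  have cc: "compact L" "convex L" "interior L \<noteq> {}"
    using L by (auto simp: convex_body_def)
  then have ne: "L \<noteq> {}"
    by auto
  obtain p q where
    p: "\<And>v. v \<in> V \<Longrightarrow> p v \<in> L" and
    min: "\<And>v y. v \<in> V \<Longrightarrow> y \<in> L \<Longrightarrow> slope v (p v) \<le> slope v y"
    and q: "\<And>v. v \<in> V \<Longrightarrow> q v \<in> L" and
    max: "\<And>v y. v \<in> V \<Longrightarrow> y \<in> L \<Longrightarrow> slope v y \<le> slope v (q v)"
    using exists_extremal_points[OF cc(1) ne] by blast
  note c = circumscribed_ratio_eq[OF p min]
  have c': "?c' = (\<Sum>v\<in>V. slope v (q v))"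
    by (rule circumscribed_ratio_uminus_eq[OF q max])

  show "0 < ?c"
  proof (rule ccontr)
    assume "\<not> 0 < ?c"
    with c(1,2) have "?c = 0"
      by linarith
    with c(1,3) obtain x where "L \<subseteq> homothet x 0 (convex hull V)"
      by auto
    then have "L \<subseteq> {x}"
      by (auto simp: homothet_def)
    then show False
      using cc(3) interior_mono[of L "{x}"] by simp
  qed

  let ?S = "{r. 0 \<le> r \<and> (\<exists>x. homothet x r (convex hull V) \<subseteq> L)}"
  have bound: "r \<le> ?c' / DIM('a)" if "r \<in> ?S" for r
    using that homothet_subset_bound[OF max] by (auto simp: c' field_simps)
  then have bdd: "bdd_above ?S"
    by (meson bdd_aboveI)
  obtain x where "x \<in> L"
    using ne by blast
  then have zero: "0 \<in> ?S"
    by (auto simp: homothet_def intro!: exI[of _ x])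
  have "?i \<le> ?c' / DIM('a)"
    unfolding inscribed_ratio_def using zero bound by (intro cSup_least) auto
  then show "DIM('a) * ?i \<le> ?c'"
    by (simp add: field_simps)

  let ?r = "?c' - (real DIM('a) - 1) * ?c"
  have "?r \<le> ?i"
  proof (cases "0 \<le> ?r")
    case True
    have eq: "?r = (\<Sum>v\<in>V. slope v (q v)) + (real DIM('a) - 1) * (\<Sum>v\<in>V. slope v (p v))"
      by (simp add: c(1) c')
    have "\<exists>x. homothet x ?r (convex hull V) \<subseteq> L"
      unfolding eq using True
      by (intro exists_inscribed_homothet min q compact_imp_closed cc) (simp_all only: eq)
    with True have "?r \<in> ?S"
      by blast
    then show ?thesis
      unfolding inscribed_ratio_def using bdd by (rule cSup_upper)
  next
    case False
    moreover have "0 \<le> ?i"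
      unfolding inscribed_ratio_def using zero bdd by (rule cSup_upper)
    ultimately show ?thesis
      by linarith
  qed
  then show "?c' \<le> (real DIM('a) - 1) * ?c + ?i"
    by linarith
qed

end

theorem theorem3:
  fixes \<Delta> L :: "(real ^ 'n) set"
  assumes "int CARD('n) simplex \<Delta>"
    and "convex_body L"
  shows "real CARD('n) / d_ratio \<Delta> L \<le> rho_ratio \<Delta> L
    \<and> rho_ratio \<Delta> L \<le> real CARD('n) - 1 + 1 / d_ratio \<Delta> L"
proof -
  obtain V where V: "\<not> affine_dependent V" "int (card V) = int CARD('n) + 1" "\<Delta> = convex hull V"
    using assms(1) unfolding simplex_def by blast
  have "aff_dim V = int DIM(real ^ 'n)"
    using aff_dim_affine_independent[OF V(1)] V(2) by simp
  then have "affine hull V = UNIV"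
    using aff_dim_eq_full by blast
  then interpret full_simplex V
    using V(1) by unfold_locales
  note b = ratio_bounds[OF assms(2), folded V(3)]
  show ?thesis
    using b by (simp add: rho_ratio_def d_ratio_def field_simps)
qed

end
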